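(* Every transfer Krull monoid is fully elastic. That is, if $H$ is a transfer Krull monoid, then for every rational number $q$ with $1 \le q < \rho(H)$ there is an $L \in \mathcal L(H)$ such that $\rho(L) = q$.
   Context: A monoid is a left and right cancellative semigroup with identity element (not necessarily commutative); monoid homomorphisms respect identities. For a monoid $H$, $H^{\times}$ is its group of units; an element $a \in H$ is an atom if $a \notin H^{\times}$ and $a = bc$ with $b,c \in H$ implies $b \in H^{\times}$ or $c \in H^{\times}$; $\mathcal A(H)$ is the set of atoms. $H$ is atomic if every non-unit is a finite product of atoms. For a non-unit $a\in H$, $\mathsf L(a) \subset \mathbb N$ is the set of all $k \in \mathbb N$ such that $a$ is a product of $k$ atoms; for $a \in H^{\times}$, $\mathsf L(a) = \{0\}$. $\mathcal L(H) = \{\mathsf L(a) \mid a \in H\}$. $H$ is a BF-monoid if it is atomic and all $L \in \mathcal L(H)$ are finite. For a nonempty $L \subset \mathbb N$, $\rho(L) = \sup L/\min L$, and $\rho(\{0\}) = 1$. For a BF-monoid, $\rho(H) = \sup\{\rho(L) \mid L \in \mathcal L(H)\} \in \mathbb R_{\ge 1} \cup \{\infty\}$. (Transfer Krull monoids are BF-monoids.) Let $G$ be an additive abelian group and $G_0 \subset G$ a subset. $\mathcal F(G_0)$ is the free abelian monoid (written multiplicatively) with basis $G_0$; for $S = g_1 \cdots g_\ell \in \mathcal F(G_0)$ put $\sigma(S) = g_1 + \dots + g_\ell \in G$. $\mathcal B(G_0) = \{S \in \mathcal F(G_0) \mid \sigma(S) = 0\}$ is the monoid of zero-sum sequences over $G_0$.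 A homomorphism $\theta \colon H \to B$ of atomic monoids is a weak transfer homomorphism if (T1) $B = B^{\times}\theta(H)B^{\times}$ and $\theta^{-1}(B^{\times}) = H^{\times}$; and (WT2) whenever $a \in H$, $n \in \mathbb N$, $v_1, \dots, v_n \in \mathcal A(B)$ and $\theta(a) = v_1 \cdots v_n$, there exist $u_1, \dots, u_n \in \mathcal A(H)$ and a permutation $\tau$ of $\{1,\dots,n\}$ such that $a = u_1 \cdots u_n$ and $\theta(u_i) \in B^{\times} v_{\tau(i)} B^{\times}$ for each $i$. An atomic monoid $H$ is a transfer Krull monoid if there are an abelian group $G$, a subset $G_0 \subset G$, and a weak transfer homomorphism $\theta \colon H \to \mathcal B(G_0)$ (equivalently, if there is a weak transfer homomorphism from $H$ to a commutative Krull monoid). *)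

theory Defs
  imports
    "HOL-Algebra.Divisibility"
    "HOL-Algebra.FiniteProduct"
    "HOL-Combinatorics.Permutations"
    "HOL-Library.Extended_Real"
begin

text \<open>
  Monoids (in the sense of cancellative, not necessarily commutative monoids) are structures
  satisfying the locale \<^locale>\<open>monoid_cancel\<close>.
\<close>

definition mprod :: "('a, 'm) monoid_scheme \<Rightarrow> 'a list \<Rightarrow> 'a" where
  "mprod H us = foldr (\<lambda>x y. x \<otimes>\<^bsub>H\<^esub> y) us \<one>\<^bsub>H\<^esub>"

text \<open>
  The library's \<open>irreducible\<close> is phrased through proper left divisors; here the
  two-sided definition customary for noncommutative monoids is used.
\<close>

definition atoms :: "('a, 'm) monoid_scheme \<Rightarrow> 'a set" where
  "atoms H = {a \<in> carrier H. a \<notin> Units H \<and>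
     (\<forall>b \<in> carrier H. \<forall>c \<in> carrier H. a = b \<otimes>\<^bsub>H\<^esub> c \<longrightarrow> b \<in> Units H \<or> c \<in> Units H)}"

definition atomic_monoid :: "('a, 'm) monoid_scheme \<Rightarrow> bool" where
  "atomic_monoid H \<longleftrightarrow> monoid_cancel H \<and>
     (\<forall>a \<in> carrier H - Units H. \<exists>us. set us \<subseteq> atoms H \<and> a = mprod H us)"

definition length_set :: "('a, 'm) monoid_scheme \<Rightarrow> 'a \<Rightarrow> nat set" where
  "length_set H a =
     (if a \<in> Units H then {0}
      else {k. \<exists>us. length us = k \<and> set us \<subseteq> atoms H \<and> a = mprod H us})"

definition length_sets :: "('a, 'm) monoid_scheme \<Rightarrow> nat set set" where
  "length_sets H = length_set H ` carrier H"

text \<open>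
  Only nonempty sets that are \<open>{0}\<close> or consist of positive integers occur as sets of
  lengths in an atomic monoid.  \<open>Inf\<close> on \<^typ>\<open>nat\<close> is the minimum of a nonempty, possibly
  infinite set; the supremum is taken in the extended reals.
\<close>

definition set_elasticity :: "nat set \<Rightarrow> ereal" where
  "set_elasticity L =
     (if L = {0} then 1 else (SUP k \<in> L. ereal (real k)) / ereal (real (Inf L)))"

definition elasticity :: "('a, 'm) monoid_scheme \<Rightarrow> ereal" where
  "elasticity H = (SUP L \<in> length_sets H. set_elasticity L)"

definition fully_elastic :: "('a, 'm) monoid_scheme \<Rightarrow> bool" where
  "fully_elastic H \<longleftrightarrow>
     (\<forall>q :: rat. 1 \<le> q \<and> ereal (of_rat q) < elasticity H \<longrightarrow>
        (\<exists>L \<in> length_sets H. set_elasticity L = ereal (of_rat q)))"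

text \<open>
  Elements of the free abelian monoid are finite multisets.  Abelian groups are
  commutative groups in the sense of \<^locale>\<open>comm_group\<close>, hence written multiplicatively:
  the sum \<open>g\<^sub>1 + \<dots> + g\<^sub>l\<close> is the product of the powers \<open>g [^] count S g\<close>, and the
  zero element is \<open>\<one>\<close>.  See \<open>seq_sum_mset\<close> below.
\<close>

definition free_abelian_monoid :: "'g set \<Rightarrow> 'g multiset monoid" where
  "free_abelian_monoid G0 =
     \<lparr>carrier = {S. set_mset S \<subseteq> G0}, monoid.mult = (\<lambda>S T. S + T), one = {#}\<rparr>"

definition seq_sum :: "('g, 'm) monoid_scheme \<Rightarrow> 'g multiset \<Rightarrow> 'g" where
  "seq_sum G S = finprod G (\<lambda>g. g [^]\<^bsub>G\<^esub> count S g) (set_mset S)"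

definition zero_sum_monoid :: "('g, 'm) monoid_scheme \<Rightarrow> 'g set \<Rightarrow> 'g multiset monoid" where
  "zero_sum_monoid G G0 = (free_abelian_monoid G0)
     \<lparr>carrier := {S \<in> carrier (free_abelian_monoid G0). seq_sum G S = \<one>\<^bsub>G\<^esub>}\<rparr>"

lemma seq_sum_mset:
  fixes G (structure)
  assumes "comm_group G" and "set gs \<subseteq> carrier G"
  shows "seq_sum G (mset gs) = foldr (\<otimes>) gs \<one>"
  using assms(2)
proof (induction gs)
  case Nil
  interpret comm_group G by fact
  show ?case by (simp add: seq_sum_def)
next
  case (Cons x gs)
  interpret comm_group G by fact
  have x: "x \<in> carrier G" and gs: "set gs \<subseteq> carrier G"
    using Cons.prems by auto
  let ?A = "insert x (set gs)"
  have c: "g [^] count (mset (x # gs)) g =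
      (if x = g then x else \<one>) \<otimes> g [^] count (mset gs) g" if "g \<in> ?A" for g
    using that x gs by (auto simp: m_comm subset_iff)
  have "seq_sum G (mset (x # gs)) =
      finprod G (\<lambda>g. (if x = g then x else \<one>) \<otimes> g [^] count (mset gs) g) ?A"
    unfolding seq_sum_def using x gs c
    by (intro finprod_cong') auto
  also have "\<dots> = finprod G (\<lambda>g. if x = g then x else \<one>) ?A \<otimes>
      finprod G (\<lambda>g. g [^] count (mset gs) g) ?A"
    using x gs by (intro finprod_multf) auto
  also have "finprod G (\<lambda>g. if x = g then x else \<one>) ?A = x"
    using x by (intro finprod_singleton) auto
  also have "finprod G (\<lambda>g. g [^] count (mset gs) g) ?A = seq_sum G (mset gs)"
    unfolding seq_sum_def set_mset_mset using x gs
    by (intro finprod_mono_neutral_cong_right)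
       (auto simp: count_eq_zero_iff[THEN iffD2])
  finally show ?case
    using Cons.IH gs by simp
qed

text \<open>
  Only factorizations of positive length are lifted (length \<open>0\<close> would force units mapped to \<open>\<one>\<close> to be
  \<open>\<one>\<close>), so \<open>vs\<close> is nonempty.
  \<^const>\<open>hom\<close> does not require identities to be preserved.
\<close>

definition weak_transfer_hom ::
  "('a, 'm) monoid_scheme \<Rightarrow> ('b, 'n) monoid_scheme \<Rightarrow> ('a \<Rightarrow> 'b) \<Rightarrow> bool" where
  "weak_transfer_hom H B \<theta> \<longleftrightarrow>
     atomic_monoid H \<and> atomic_monoid B \<and> \<theta> \<in> hom H B \<and> \<theta> \<one>\<^bsub>H\<^esub> = \<one>\<^bsub>B\<^esub> \<and>
     carrier B = Units B <#>\<^bsub>B\<^esub> \<theta> ` carrier H <#>\<^bsub>B\<^esub> Units B \<and>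
     {a \<in> carrier H. \<theta> a \<in> Units B} = Units H \<and>
     (\<forall>a \<in> carrier H. \<forall>vs. vs \<noteq> [] \<and> set vs \<subseteq> atoms B \<and> \<theta> a = mprod B vs \<longrightarrow>
        (\<exists>us \<tau>. length us = length vs \<and> set us \<subseteq> atoms H \<and> \<tau> permutes {..<length vs} \<and>
           a = mprod H us \<and>
           (\<forall>i < length vs. \<theta> (us ! i) \<in> Units B <#>\<^bsub>B\<^esub> {vs ! \<tau> i} <#>\<^bsub>B\<^esub> Units B)))"

text \<open>
  The type argument names the type in which the abelian group \<open>G\<close> lives, since HOL cannot
  quantify existentially over types.  A result assuming this predicate for an arbitrary
  type \<open>'g\<close> covers all abelian groups.
\<close>

definition transfer_Krull_monoid :: "'g itself \<Rightarrow> ('a, 'm) monoid_scheme \<Rightarrow> bool" where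
  "transfer_Krull_monoid T H \<longleftrightarrow> atomic_monoid H \<and>
     (\<exists>(G :: 'g monoid) G0 \<theta>. comm_group G \<and> G0 \<subseteq> carrier G \<and>
        weak_transfer_hom H (zero_sum_monoid G G0) \<theta>)"

end

theory Submission
  imports Defs
begin

text \<open>
  A weak transfer homomorphism preserves sets of lengths and, the monoid of zero-sum sequences
  being reduced, is surjective, so \<open>H\<close> has the same system of sets of lengths as \<open>\<B>(G\<^sub>0)\<close>
  (\<open>length_set_transfer\<close>).  The only property of \<open>\<B>(G\<^sub>0)\<close> that matters is that it is a
  set of multisets closed under addition and under subtraction of submultisets; the
  locale \<open>saturated\<close> captures this.

  Let \<open>q = m / n > 1\<close> in such a monoid, and let \<open>A\<close> be an element with lengths \<open>k\<close> and \<open>l\<close>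
  such that \<open>k / l > q\<close>.  Consider all pairs \<open>(x, y)\<close> of factorizations of a common nontrivial
  element \<open>S\<close> supported in \<open>supp A\<close> with \<open>|x| / |y| \<ge> q\<close>.  Fix an atom \<open>C\<close> which is the only
  atom supported in \<open>supp C \<subseteq> supp A\<close>; it exists because two elements of minimal support are
  proportional.  The elements supported in \<open>supp C\<close> are powers of \<open>C\<close> and factor uniquely, so
  in every such pair \<open>S\<close> has a letter outside \<open>supp C\<close>.  Hence the slope of \<open>S\<close>, the number of
  letters of \<open>S\<close> inside \<open>supp C\<close> divided by the number of letters outside, is well defined.

  The pairs, together with the slack \<open>n |x| - m |y|\<close>, form the solutions of homogeneous linear
  Diophantine constraints, so by Dickson's lemma they are generated by finitely many minimal ones.
  The slope of a sum never exceeds the larger of the slopes of the summands, so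
  the slope attains its maximum (\<open>slope_max_attained\<close>).  At an \<open>S\<close> of maximal slope, no
  two factorizations \<open>x'\<close>, \<open>y'\<close> have \<open>n |x'| > m |y'|\<close>: otherwise the positive slack of a high
  multiple of \<open>(x', y')\<close> would pay for adding the atom \<open>C\<close> to both factorizations, which increases
  the slope.  So \<open>n |x| = m |y|\<close>, where \<open>|x|\<close> is the maximal and \<open>|y|\<close> the minimal length of \<open>S\<close>,
  and the elasticity of the set of lengths of \<open>S\<close> is exactly \<open>q\<close> (\<open>exists_extremal_element\<close>).
\<close>

section \<open>Dickson's lemma\<close>

text \<open>
  A monotone subsequence exists in every linear order; over \<open>nat\<close> a decreasing one
  becomes constant once it reaches its least value, so it has a nondecreasing tail.
\<close>

lemma nat_seq_mono_subseq:
  fixes s :: "nat \<Rightarrow> nat"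
  shows "\<exists>r :: nat \<Rightarrow> nat. strict_mono r \<and> mono (s \<circ> r)"
proof -
  obtain r :: "nat \<Rightarrow> nat" where r: "strict_mono r" "monoseq (\<lambda>k. s (r k))"
    using seq_monosub[of s] by blast
  show ?thesis
  proof (cases "incseq (\<lambda>k. s (r k))")
    case True
    then show ?thesis using r(1) by (auto simp: mono_def)
  next
    case False
    then have dec: "decseq (\<lambda>k. s (r k))"
      using r(2) by (simp add: monoseq_iff)
    define c where "c = (LEAST v. \<exists>k. v = s (r k))"
    have "\<exists>k. c = s (r k)"
      unfolding c_def by (rule LeastI_ex[where P="\<lambda>v. \<exists>k. v = s (r k)"]) blast
    then obtain N where N: "c = s (r N)" ..
    have least: "c \<le> s (r k)" for k
      unfolding c_def by (rule Least_le) auto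
    have const: "s (r (N + k)) = c" for k
      using least[of "N + k"] decseqD[OF dec, of N "N + k"] N by simp
    have "strict_mono (\<lambda>k. r (N + k))"
      using r(1) by (simp add: strict_mono_def)
    moreover have "mono (s \<circ> (\<lambda>k. r (N + k)))"
      by (simp add: mono_def const)
    ultimately show ?thesis by blast
  qed
qed

lemma finite_family_mono_subseq:
  fixes F :: "(nat \<Rightarrow> nat) set"
  assumes "finite F"
  shows "\<exists>r :: nat \<Rightarrow> nat. strict_mono r \<and> (\<forall>\<phi>\<in>F. mono (\<phi> \<circ> r))"
  using assms
proof (induction F)
  case empty
  then show ?case using strict_mono_id by blast
next
  case (insert \<psi> F)
  then obtain r :: "nat \<Rightarrow> nat" where r: "strict_mono r" "\<forall>\<phi>\<in>F. mono (\<phi> \<circ> r)" by blast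
  obtain t :: "nat \<Rightarrow> nat" where t: "strict_mono t" "mono ((\<psi> \<circ> r) \<circ> t)"
    using nat_seq_mono_subseq[of "\<psi> \<circ> r"] by blast
  have "mono (\<phi> \<circ> (r \<circ> t))" if "\<phi> \<in> F" for \<phi>
    using r(2) that strict_mono_mono[OF t(1)] by (auto simp: mono_def)
  moreover have "mono (\<psi> \<circ> (r \<circ> t))" using t(2) by (simp add: o_assoc)
  moreover have "strict_mono (r \<circ> t)" using r(1) t(1) by (rule strict_mono_o)
  ultimately show ?case by blast
qed

text \<open>
  Dickson's lemma, in coordinate form: \<open>F\<close> is a finite family of coordinates.  Letting
  the coordinates vary freely covers multisets over a finite set as well as pairs of them with
  an additional slack variable.
\<close>

lemma finite_antichain:
  fixes F :: "('q \<Rightarrow> nat) set"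
  assumes F: "finite F"
    and anti: "\<And>p p'. p \<in> M \<Longrightarrow> p' \<in> M \<Longrightarrow> (\<And>\<phi>. \<phi> \<in> F \<Longrightarrow> \<phi> p \<le> \<phi> p') \<Longrightarrow> p = p'"
  shows "finite M"
proof (rule ccontr)
  assume "infinite M"
  then obtain e :: "nat \<Rightarrow> 'q" where e: "inj e" "range e \<subseteq> M"
    using infinite_countable_subset by blast
  obtain r :: "nat \<Rightarrow> nat" where r: "strict_mono r"
    and mono: "\<forall>\<phi>\<in>(\<lambda>\<phi>. \<phi> \<circ> e) ` F. mono (\<phi> \<circ> r)"
    using finite_family_mono_subseq[of "(\<lambda>\<phi>. \<phi> \<circ> e) ` F"] F by blast
  have "e (r 0) = e (r 1)"
  proof (rule anti)
    fix \<phi> assume "\<phi> \<in> F"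
    then have "mono ((\<phi> \<circ> e) \<circ> r)" using mono by blast
    from monoD[OF this, of 0 1] show "\<phi> (e (r 0)) \<le> \<phi> (e (r 1))" by simp
  qed (use e in auto)
  then have "r 0 = r 1" using e(1) by (simp add: inj_eq)
  with r show False by (simp add: strict_mono_eq)
qed

section \<open>Saturated monoids of multisets\<close>

lemma set_repeat_mset_subset: "set_mset (repeat_mset k S) \<subseteq> set_mset S"
proof
  fix a assume "a \<in># repeat_mset k S"
  then have "count (repeat_mset k S) a > 0" by (simp only: count_greater_zero_iff)
  then have "count S a > 0" by simp
  then show "a \<in># S" by (simp only: count_greater_zero_iff)
qed

lemma subset_mset_on_support:
  assumes "set_mset x \<subseteq> A" "\<And>a. a \<in> A \<Longrightarrow> count x a \<le> count y a"
  shows "x \<subseteq># y"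
proof (rule mset_subset_eqI)
  fix a show "count x a \<le> count y a"
    using assms by (cases "a \<in># x") (auto simp: not_in_iff)
qed

lemma size_repeat_mset [simp]: "size (repeat_mset k S) = k * size S"
  by (induction k) auto

lemma sum_repeat_mset [simp]: "\<Sum>\<^sub># (repeat_mset k x) = repeat_mset k (\<Sum>\<^sub># x)"
  for x :: "'b multiset multiset"
  by (induction k) auto

locale saturated =
  fixes Z :: "'g multiset set"
  assumes zero: "{#} \<in> Z"
    and add: "S \<in> Z \<Longrightarrow> T \<in> Z \<Longrightarrow> S + T \<in> Z"
    and cancel: "S \<in> Z \<Longrightarrow> S + T \<in> Z \<Longrightarrow> T \<in> Z"
begin

text \<open>
  The atoms: closure under subtraction makes divisibility in \<open>Z\<close> the same as inclusion of multisets.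
\<close>

definition irr :: "'g multiset set" where
  "irr = {U \<in> Z. U \<noteq> {#} \<and> (\<forall>S\<in>Z. S \<subseteq># U \<longrightarrow> S = {#} \<or> S = U)}"

definition fact_lengths :: "'g multiset \<Rightarrow> nat set" where
  "fact_lengths S = {size x |x. set_mset x \<subseteq> irr \<and> \<Sum>\<^sub># x = S}"

lemma diff: "S \<in> Z \<Longrightarrow> T \<in> Z \<Longrightarrow> S \<subseteq># T \<Longrightarrow> T - S \<in> Z"
  using cancel[of S "T - S"] by simp

lemma repeat: "S \<in> Z \<Longrightarrow> repeat_mset k S \<in> Z"
  by (induction k) (auto simp: zero add)

lemma sum_irr_mem: "set_mset x \<subseteq> irr \<Longrightarrow> \<Sum>\<^sub># x \<in> Z"
  by (induction x) (auto simp: zero add irr_def)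

lemma irr_below:
  assumes "S \<in> Z" "S \<noteq> {#}"
  shows "\<exists>U\<in>irr. U \<subseteq># S"
  using assms
proof (induction "size S" arbitrary: S rule: less_induct)
  case less
  show ?case
  proof (cases "S \<in> irr")
    case False
    then obtain T where "T \<in> Z" "T \<subseteq># S" "T \<noteq> {#}" "T \<noteq> S"
      using less.prems by (auto simp: irr_def)
    moreover from this have "size T < size S"
      by (intro mset_subset_size) (simp add: subset_mset.less_le)
    ultimately show ?thesis
      using less.hyps[of T] subset_mset.order_trans by blast
  qed auto
qed

lemma factorization_exists:
  assumes "S \<in> Z"
  shows "\<exists>x. set_mset x \<subseteq> irr \<and> \<Sum>\<^sub># x = S"
  using assms
proof (induction "size S" arbitrary: S rule: less_induct)
  case less
  show ?case
  proof (cases "S = {#}")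
    case True
    then show ?thesis by (intro exI[of _ "{#}"]) auto
  next
    case False
    then obtain U where U: "U \<in> irr" "U \<subseteq># S" using irr_below less.prems by blast
    then have "U \<in> Z" "U \<noteq> {#}" by (auto simp: irr_def)
    then have "size (S - U) < size S"
      using U(2) by (simp add: size_Diff_submset mset_subset_eq_exists_conv nonempty_has_size)
        (metis U(2) \<open>U \<noteq> {#}\<close> diff_less nonempty_has_size size_mset_mono less_le_trans)
    then obtain x where "set_mset x \<subseteq> irr" "\<Sum>\<^sub># x = S - U"
      using less.hyps diff[OF \<open>U \<in> Z\<close> less.prems U(2)] by blast
    then show ?thesis using U by (intro exI[of _ "add_mset U x"]) auto
  qed
qed

lemma finite_irr_over:
  assumes "finite G'"
  shows "finite {U \<in> irr. set_mset U \<subseteq> G'}"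
proof (rule finite_antichain)
  show "finite ((\<lambda>g U. count U g) ` G')" using assms by simp
  fix U V
  assume UV: "U \<in> {U \<in> irr. set_mset U \<subseteq> G'}" "V \<in> {U \<in> irr. set_mset U \<subseteq> G'}"
    and le: "\<And>\<phi>. \<phi> \<in> (\<lambda>g U. count U g) ` G' \<Longrightarrow> \<phi> U \<le> \<phi> V"
  have "U \<subseteq># V"
    using UV le by (intro subset_mset_on_support[of U G']) auto
  then show "U = V" using UV by (auto simp: irr_def)
qed

text \<open>
  Among the nontrivial elements supported in \<open>supp A\<close>, choose one with the fewest distinct letters,
  and let \<open>E\<close> be its support.  If \<open>U\<close> and \<open>C\<close> are nontrivial and supported in \<open>E\<close>, then
  subtracting suitable multiples kills a letter, so by minimality the difference is trivial and
  \<open>U\<close> and \<open>C\<close> are proportional.  Proportional multisets are comparable, and comparable atoms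
  are equal.
\<close>

lemma exists_unique_irr_face:
  assumes A: "A \<in> Z" "A \<noteq> {#}"
  shows "\<exists>C\<in>irr. set_mset C \<subseteq> set_mset A \<and> (\<forall>U\<in>irr. set_mset U \<subseteq> set_mset C \<longrightarrow> U = C)"
proof -
  define P where "P = (\<lambda>E. \<exists>T\<in>Z. T \<noteq> {#} \<and> set_mset T = E \<and> E \<subseteq> set_mset A)"
  have "P (set_mset A)" using A by (auto simp: P_def)
  then obtain E where E: "P E" and least: "\<And>E'. P E' \<Longrightarrow> card E \<le> card E'"
    using exists_least_iff[of "\<lambda>k. \<exists>E. P E \<and> card E = k"] by (metis not_le)
  from E have "finite E" by (auto simp: P_def)
  have full: "T = {#}" if "T \<in> Z" "set_mset T \<subset> E" for T
  proof (rule ccontr)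
    assume "T \<noteq> {#}"
    then have "P (set_mset T)" using that E by (auto simp: P_def)
    with least have "card E \<le> card (set_mset T)" .
    with psubset_card_mono[OF \<open>finite E\<close> that(2)] show False by simp
  qed
  have eq_E: "set_mset T = E" if "T \<in> Z" "T \<noteq> {#}" "set_mset T \<subseteq> E" for T
    using full[OF that(1)] that by blast
  obtain T where T: "T \<in> Z" "T \<noteq> {#}" "set_mset T = E" "E \<subseteq> set_mset A"
    using E by (auto simp: P_def)
  obtain C where C: "C \<in> irr" "C \<subseteq># T" using irr_below[OF T(1,2)] by blast
  have CZ: "C \<in> Z" "C \<noteq> {#}" using C by (auto simp: irr_def)
  have CE: "set_mset C = E" using eq_E CZ set_mset_mono[OF C(2)] T(3) by blast
  have "U = C" if U: "U \<in> irr" "set_mset U \<subseteq> E" for U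
  proof -
    have UZ: "U \<in> Z" "U \<noteq> {#}" using U by (auto simp: irr_def)
    have UE: "set_mset U = E" using eq_E UZ U by blast
    have "E \<noteq> {}" using CZ CE by auto
    \<comment> \<open>With the ratio of multiplicities minimal at \<open>g\<close>, the multiple of \<open>U\<close> that agrees at \<open>g\<close>
        with a multiple of \<open>C\<close> lies below it everywhere.\<close>
    define g where "g = arg_min_on (\<lambda>g. real (count C g) / real (count U g)) E"
    have gE: "g \<in> E"
      unfolding g_def by (rule arg_min_if_finite(1)[OF \<open>finite E\<close> \<open>E \<noteq> {}\<close>])
    have gmin: "real (count C g) / real (count U g) \<le> real (count C h) / real (count U h)"
      if "h \<in> E" for h
      unfolding g_def by (rule arg_min_least[OF \<open>finite E\<close> \<open>E \<noteq> {}\<close> that])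
    have pos: "count U h > 0" "count C h > 0" if "h \<in> E" for h
      using that UE CE by auto
    let ?u = "count U g" and ?c = "count C g"
    have le: "?c * count U h \<le> ?u * count C h" for h
    proof (cases "h \<in> E")
      case True
      then have "real ?c * real (count U h) \<le> real ?u * real (count C h)"
        using gmin[OF True] pos[OF True] pos[OF gE] by (simp add: field_simps)
      then show ?thesis by (metis of_nat_le_iff of_nat_mult)
    next
      case False
      then have "count U h = 0" using UE by (metis not_in_iff)
      then show ?thesis by simp
    qed
    have sub: "repeat_mset ?c U \<subseteq># repeat_mset ?u C"
      using le by (simp add: subseteq_mset_def)
    let ?D = "repeat_mset ?u C - repeat_mset ?c U"
    have "?D \<in> Z" by (intro diff repeat UZ CZ sub)
    moreover have "set_mset ?D \<subset> E"
    proof -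
      have "set_mset ?D \<subseteq> E" using CE set_repeat_mset_subset[of ?u C] by (auto dest: in_diffD)
      moreover have "g \<notin># ?D" by (simp add: not_in_iff)
      ultimately show ?thesis using gE by blast
    qed
    ultimately have "?D = {#}" by (rule full)
    then have prop_eq: "?c * count U h = ?u * count C h" for h
      using le[of h] by (metis count_diff count_empty count_repeat_mset diff_is_0_eq le_antisym)
    have "U \<subseteq># C \<or> C \<subseteq># U"
    proof (cases "?u \<le> ?c")
      case True
      have "count U h \<le> count C h" for h
      proof -
        have "?c * count U h \<le> ?c * count C h" using prop_eq[of h] True by simp
        then show ?thesis using pos[OF gE] by simp
      qed
      then show ?thesis by (simp add: subseteq_mset_def)
    next
      case False
      have "count C h \<le> count U h" for h
      proof -
        have "?u * count C h \<le> ?u * count U h" using prop_eq[of h, symmetric] False by simp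
        then show ?thesis using pos[OF gE] by simp
      qed
      then show ?thesis by (simp add: subseteq_mset_def)
    qed
    then show "U = C" using U(1) C(1) UZ CZ by (auto simp: irr_def)
  qed
  then show ?thesis using C(1) CE T(4) by blast
qed

text \<open>
  Pairs of factorizations, over \<open>G'\<close>, of the same element whose lengths have ratio at least \<open>m / n\<close>.
  The trivial element is excluded because its slope would be undefined.
\<close>

definition elastic_pairs :: "'g set \<Rightarrow> nat \<Rightarrow> nat \<Rightarrow> ('g multiset multiset \<times> 'g multiset multiset) set" where
  "elastic_pairs G' m n = {(x, y). set_mset x \<subseteq> {U \<in> irr. set_mset U \<subseteq> G'} \<and>
     set_mset y \<subseteq> {U \<in> irr. set_mset U \<subseteq> G'} \<and> \<Sum>\<^sub># x = \<Sum>\<^sub># y \<and> \<Sum>\<^sub># x \<noteq> {#} \<and>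
     m * size y \<le> n * size x}"

lemma sum_irr_empty: "set_mset x \<subseteq> irr \<Longrightarrow> \<Sum>\<^sub># x = {#} \<longleftrightarrow> x = {#}"
  by (auto simp: irr_def)

text \<open>
  The slope of an element \<open>S\<close> is \<open>v S / u S\<close> for additive functionals \<open>v\<close> and \<open>u\<close>.
  Minimality is taken with respect to inclusion of both factorizations and comparison of the slacks,
  as only then is the difference of two comparable pairs again such a pair.
  The minimal pairs are finitely many by Dickson's lemma, every pair is a sum of minimal ones,
  and a linear inequality \<open>v \<cdot> b \<le> a \<cdot> u\<close> that holds for all the summands holds for the sum.
  The conclusion is cross-multiplied to stay within the natural numbers.
\<close>

lemma slope_max_attained:
  assumes fin: "finite G'" and ne: "elastic_pairs G' m n \<noteq> {}"
    and v: "\<And>S T. v (S + T) = v S + v T" and u: "\<And>S T. u (S + T) = u S + (u T :: nat)"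
    and pos: "\<And>x y. (x, y) \<in> elastic_pairs G' m n \<Longrightarrow> u (\<Sum>\<^sub># x) > 0"
  shows "\<exists>(x, y) \<in> elastic_pairs G' m n. \<forall>(x', y') \<in> elastic_pairs G' m n.
           v (\<Sum>\<^sub># x') * u (\<Sum>\<^sub># x) \<le> (v (\<Sum>\<^sub># x) :: nat) * u (\<Sum>\<^sub># x')"
proof -
  let ?A = "{U \<in> irr. set_mset U \<subseteq> G'}"
  let ?Q = "elastic_pairs G' m n"
  define slack :: "'g multiset multiset \<times> 'g multiset multiset \<Rightarrow> nat"
    where "slack = (\<lambda>(x, y). n * size x - m * size y)"
  define le where "le = (\<lambda>p p' :: 'g multiset multiset \<times> 'g multiset multiset.
    fst p \<subseteq># fst p' \<and> snd p \<subseteq># snd p' \<and> slack p \<le> slack p')"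
  define M where "M = {p \<in> ?Q. \<forall>p'\<in>?Q. le p' p \<longrightarrow> p' = p}"
  have "finite M"
  proof (rule finite_antichain)
    let ?F = "(\<lambda>U p. count (fst p) U) ` ?A \<union> (\<lambda>U p. count (snd p) U) ` ?A \<union> {slack}"
    show "finite ?F" using finite_irr_over[OF fin] by simp
    fix p p' assume pM: "p \<in> M" "p' \<in> M" and mono: "\<And>\<phi>. \<phi> \<in> ?F \<Longrightarrow> \<phi> p \<le> \<phi> p'"
    have supp: "set_mset (fst p) \<subseteq> ?A" "set_mset (snd p) \<subseteq> ?A"
      using pM(1) by (auto simp: M_def elastic_pairs_def)
    have "fst p \<subseteq># fst p'"
      using supp(1) mono[of "\<lambda>p. count (fst p) U" for U] by (intro subset_mset_on_support) blast+
    moreover have "snd p \<subseteq># snd p'"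
      using supp(2) mono[of "\<lambda>p. count (snd p) U" for U] by (intro subset_mset_on_support) blast+
    ultimately have "le p p'" using mono[of slack] by (simp add: le_def)
    then show "p = p'" using pM by (auto simp: M_def)
  qed
  have size_less: "size (fst p') + size (snd p') < size (fst p) + size (snd p)"
    if "le p' p" "p' \<noteq> p" for p p'
  proof -
    have "fst p' \<subset># fst p \<or> snd p' \<subset># snd p"
      using that by (auto simp: le_def subset_mset.less_le prod_eq_iff)
    then show ?thesis
      using that(1) by (auto simp: le_def dest!: mset_subset_size size_mset_mono)
  qed
  have below: "\<exists>p'\<in>M. le p' p" if "p \<in> ?Q" for p
    using that
  proof (induction "size (fst p) + size (snd p)" arbitrary: p rule: less_induct)
    case less
    show ?case
    proof (cases "p \<in> M")
      case True
      then show ?thesis by (auto simp: le_def)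
    next
      case False
      then obtain p' where p': "p' \<in> ?Q" "le p' p" "p' \<noteq> p"
        using less.prems by (auto simp: M_def)
      obtain p'' where "p'' \<in> M" "le p'' p'" using less.hyps[OF size_less[OF p'(2,3)] p'(1)] by blast
      then show ?thesis using p'(2) by (auto simp: le_def intro!: bexI[of _ p''])
    qed
  qed
  define a b where "a = (\<lambda>p :: 'g multiset multiset \<times> 'g multiset multiset. v (\<Sum>\<^sub># (fst p)))"
    and "b = (\<lambda>p :: 'g multiset multiset \<times> 'g multiset multiset. u (\<Sum>\<^sub># (fst p)))"
  have bpos: "b p > 0" if "p \<in> ?Q" for p
    using pos[of "fst p" "snd p"] that by (simp add: b_def)
  have "M \<noteq> {}" using ne below by blast
  define p where "p = arg_min_on (\<lambda>p. - (real (a p) / real (b p))) M"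
  have pM: "p \<in> M" unfolding p_def using arg_min_if_finite[OF \<open>finite M\<close> \<open>M \<noteq> {}\<close>] by blast
  then have pQ: "p \<in> ?Q" by (simp add: M_def)
  have best_M: "a p' * b p \<le> a p * b p'" if "p' \<in> M" for p'
  proof -
    have "real (a p') / real (b p') \<le> real (a p) / real (b p)"
      using arg_min_least[OF \<open>finite M\<close> \<open>M \<noteq> {}\<close> that, of "\<lambda>p. - (real (a p) / real (b p))"]
      by (simp add: p_def)
    moreover have "b p > 0" "b p' > 0" using bpos pQ that by (auto simp: M_def)
    ultimately have "real (a p') * real (b p) \<le> real (a p) * real (b p')"
      by (simp add: field_simps)
    then show ?thesis by (metis of_nat_le_iff of_nat_mult)
  qed
  have best: "a p' * b p \<le> a p * b p'" if "p' \<in> ?Q" for p'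
    using that
  proof (induction "size (fst p') + size (snd p')" arbitrary: p' rule: less_induct)
    case less
    obtain g where g: "g \<in> M" "le g p'" using below less.prems by blast
    show ?case
    proof (cases "g = p'")
      case True
      then show ?thesis using best_M g by blast
    next
      case False
      define d where "d = (fst p' - fst g, snd p' - snd g)"
      have gQ: "g \<in> ?Q" using g by (simp add: M_def)
      have sub: "fst g \<subseteq># fst p'" "snd g \<subseteq># snd p'" using g by (auto simp: le_def)
      have sp: "fst p' = fst g + fst d" "snd p' = snd g + snd d"
        using sub by (simp_all add: d_def)
      have irr: "set_mset (fst d) \<subseteq> ?A" "set_mset (snd d) \<subseteq> ?A"
        using less.prems sp by (auto simp: elastic_pairs_def)
      have eq: "\<Sum>\<^sub># (fst d) = \<Sum>\<^sub># (snd d)"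
        using less.prems gQ sp by (auto simp: elastic_pairs_def)
      have "fst d \<noteq> {#} \<or> snd d \<noteq> {#}" using False sp by (auto simp: prod_eq_iff)
      then have ne0: "\<Sum>\<^sub># (fst d) \<noteq> {#}"
        using sum_irr_empty[of "fst d"] sum_irr_empty[of "snd d"] irr eq
        by (metis (no_types, lifting) Collect_subset subset_trans Collect_mem_eq mem_Collect_eq subset_iff)
      have "slack g \<le> slack p'" using g by (simp add: le_def)
      moreover have "m * size (snd g) \<le> n * size (fst g)" "m * size (snd p') \<le> n * size (fst p')"
        using gQ less.prems by (auto simp: elastic_pairs_def)
      ultimately have "m * size (snd d) \<le> n * size (fst d)"
        using sp by (simp add: slack_def split_beta algebra_simps)
      then have dQ: "d \<in> ?Q"
        using irr eq ne0 by (simp add: elastic_pairs_def split_beta del: sum_mset_0_iff Union_mset_empty_conv)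
      \<comment> \<open>\<open>g\<close> is nontrivial, so the remainder \<open>d\<close> is smaller than \<open>p'\<close>.\<close>
      have "g \<noteq> ({#}, {#})" using gQ by (auto simp: elastic_pairs_def)
      then have "size (fst d) + size (snd d) < size (fst p') + size (snd p')"
        using sp by (auto simp: prod_eq_iff nonempty_has_size)
      then have "a d * b p \<le> a p * b d" using less.hyps dQ by blast
      moreover have "a p' = a g + a d" "b p' = b g + b d"
        using sp by (simp_all add: a_def b_def u v)
      ultimately show ?thesis using best_M[OF g(1)] by (simp add: algebra_simps)
    qed
  qed
  then show ?thesis using pQ by (intro bexI[of _ p]) (auto simp: a_def b_def split_beta)
qed

text \<open>
  The core of the argument: the element of largest slope, for the slope relative to the support of
  an atom \<open>C\<close> as above, has all its lengths between \<open>l\<close> and \<open>k\<close> with \<open>k / l\<close> equal to \<open>m / n\<close>.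
\<close>

theorem exists_extremal_element:
  assumes A: "A \<in> Z" and kl: "k \<in> fact_lengths A" "l \<in> fact_lengths A" "m * l < n * k"
    and n: "0 < n" and nm: "n < m"
  shows "\<exists>S\<in>Z. S \<noteq> {#} \<and> (\<exists>k\<in>fact_lengths S. \<exists>l\<in>fact_lengths S. n * k = m * l \<and>
           (\<forall>i\<in>fact_lengths S. l \<le> i \<and> i \<le> k))"
proof -
  let ?G = "set_mset A"
  let ?A = "{U \<in> irr. set_mset U \<subseteq> ?G}"
  let ?Q = "elastic_pairs ?G m n"
  have over: "set_mset x \<subseteq> ?A" if "set_mset x \<subseteq> irr" "set_mset (\<Sum>\<^sub># x) \<subseteq> ?G" for x
    using that by auto
  obtain x0 y0 where xy0: "set_mset x0 \<subseteq> irr" "\<Sum>\<^sub># x0 = A" "size x0 = k"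
    "set_mset y0 \<subseteq> irr" "\<Sum>\<^sub># y0 = A" "size y0 = l"
    using kl by (auto simp: fact_lengths_def)
  have "A \<noteq> {#}" using xy0 kl(3) sum_irr_empty[of x0] by auto
  have "(x0, y0) \<in> ?Q"
    using xy0 over[of x0] over[of y0] kl(3) \<open>A \<noteq> {#}\<close> by (auto simp: elastic_pairs_def)
  then have ne: "?Q \<noteq> {}" by blast
  obtain C where C: "C \<in> irr" "set_mset C \<subseteq> ?G"
    and uniq: "\<And>U. U \<in> irr \<Longrightarrow> set_mset U \<subseteq> set_mset C \<Longrightarrow> U = C"
    using exists_unique_irr_face[OF A \<open>A \<noteq> {#}\<close>] by blast
  have Cne: "C \<noteq> {#}" using C by (simp add: irr_def)
  define v where "v = (\<lambda>S. size (filter_mset (\<lambda>g. g \<in># C) S))"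
  define u where "u = (\<lambda>S. size (filter_mset (\<lambda>g. g \<notin># C) S))"
  have pos: "u (\<Sum>\<^sub># x) > 0" if "(x, y) \<in> ?Q" for x y
  proof (rule ccontr)
    assume "\<not> u (\<Sum>\<^sub># x) > 0"
    then have "filter_mset (\<lambda>g. g \<notin># C) (\<Sum>\<^sub># x) = {#}"
      by (simp add: u_def)
    then have sub: "set_mset (\<Sum>\<^sub># x) \<subseteq> set_mset C"
      by (metis (mono_tags, lifting) empty_iff filter_mset_eq_conv set_mset_empty mem_Collect_eq
          set_mset_filter subsetI)
    have q: "set_mset x \<subseteq> irr" "set_mset y \<subseteq> irr" "\<Sum>\<^sub># x = \<Sum>\<^sub># y" "\<Sum>\<^sub># x \<noteq> {#}"
      "m * size y \<le> n * size x"
      using that by (auto simp: elastic_pairs_def simp del: sum_mset_0_iff Union_mset_empty_conv)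
    have only_C: "set_mset z \<subseteq> {C}" if "set_mset z \<subseteq> irr" "set_mset (\<Sum>\<^sub># z) \<subseteq> set_mset C" for z
    proof
      fix U assume "U \<in># z"
      moreover from this have "set_mset U \<subseteq> set_mset C" using that(2) by auto
      ultimately show "U \<in> {C}" using uniq that(1) by auto
    qed
    have "set_mset x \<subseteq> {C}" using only_C q(1) sub .
    moreover have "set_mset y \<subseteq> {C}" using only_C q(2) sub[unfolded q(3)] .
    ultimately have xC: "x = replicate_mset (size x) C" and yC: "y = replicate_mset (size y) C"
      by (simp_all add: set_mset_subset_singletonD)
    have "size (\<Sum>\<^sub># x) = size x * size C" "size (\<Sum>\<^sub># y) = size y * size C"
      by (subst xC, simp, subst yC, simp)
    then have "size x = size y" using q(3) Cne by (simp add: nonempty_has_size)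
    moreover have "size x > 0" using q(4) by (auto simp: nonempty_has_size[symmetric])
    ultimately show False using q(5) nm by simp
  qed
  obtain x y where xy: "(x, y) \<in> ?Q"
    and best: "\<And>x' y'. (x', y') \<in> ?Q \<Longrightarrow> v (\<Sum>\<^sub># x') * u (\<Sum>\<^sub># x) \<le> v (\<Sum>\<^sub># x) * u (\<Sum>\<^sub># x')"
    using slope_max_attained[of ?G m n v u, OF _ ne] pos by (fastforce simp: v_def u_def)
  define S where "S = \<Sum>\<^sub># x"
  have S: "set_mset x \<subseteq> ?A" "set_mset y \<subseteq> ?A" "\<Sum>\<^sub># y = S" "S \<noteq> {#}" "m * size y \<le> n * size x"
    using xy by (auto simp: elastic_pairs_def S_def simp del: Union_mset_empty_conv)
  have SG: "set_mset S \<subseteq> ?G" using S(1) by (auto simp: S_def)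
  have no_gap: "n * size x' \<le> m * size y'"
    if x': "set_mset x' \<subseteq> irr" "\<Sum>\<^sub># x' = S" and y': "set_mset y' \<subseteq> irr" "\<Sum>\<^sub># y' = S" for x' y'
  proof (rule ccontr)
    assume gap: "\<not> n * size x' \<le> m * size y'"
    \<comment> \<open>The gap yields slack at least \<open>1\<close> in \<open>(x', y')\<close>, while adding \<open>C\<close> to both sides costs
        \<open>m - n\<close>; hence \<open>m\<close> copies of the pair suffice.\<close>
    define x'' where "x'' = add_mset C (repeat_mset m x')"
    define y'' where "y'' = add_mset C (repeat_mset m y')"
    have sum: "\<Sum>\<^sub># x'' = C + repeat_mset m S" "\<Sum>\<^sub># y'' = C + repeat_mset m S"
      using x' y' by (simp_all add: x''_def y''_def)
    have A'': "set_mset x' \<subseteq> ?A" "set_mset y' \<subseteq> ?A"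
      using over[of x'] over[of y'] x' y' SG by simp_all
    have "m * (m * size y' + 1) \<le> m * (n * size x')" using gap by (intro mult_le_mono2) simp
    then have "m * size y'' \<le> n * size x''"
      by (simp add: x''_def y''_def algebra_simps)
    then have "(x'', y'') \<in> ?Q"
      using sum A'' C Cne set_repeat_mset_subset[of m x'] set_repeat_mset_subset[of m y']
      by (auto simp: elastic_pairs_def x''_def y''_def split: if_splits)
    from best[OF this] have
      "v (C + repeat_mset m S) * u S \<le> v S * u (C + repeat_mset m S)"
      by (simp add: sum S_def)
    moreover have "v (repeat_mset j S) = j * v S" "u (repeat_mset j S) = j * u S" for j
      by (induction j) (simp_all add: v_def u_def)
    moreover have "v (C + T) = v C + v T" "u (C + T) = u C + u T" for T
      by (simp_all add: v_def u_def)
    moreover have "v C = size C" "u C = 0"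
      by (simp_all add: v_def u_def filter_mset_eq_conv cong: filter_mset_cong)
    ultimately have "size C * u S \<le> 0"
      by (simp add: algebra_simps)
    then show False using pos[OF xy] Cne by (simp add: S_def)
  qed
  have irr_xy: "set_mset x \<subseteq> irr" "set_mset y \<subseteq> irr" using S by auto
  have eq: "n * size x = m * size y"
    using no_gap[OF irr_xy(1) S_def[symmetric] irr_xy(2) S(3)] S(5) by simp
  have "size y \<le> size z \<and> size z \<le> size x" if "set_mset z \<subseteq> irr" "\<Sum>\<^sub># z = S" for z
  proof -
    have "m * size y \<le> m * size z" "n * size z \<le> n * size x"
      using no_gap[OF irr_xy(1) S_def[symmetric] that] no_gap[OF that irr_xy(2) S(3)] eq by simp_all
    then show ?thesis using n nm by simp
  qed
  moreover have "size x \<in> fact_lengths S" "size y \<in> fact_lengths S"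
    using irr_xy S(3) by (auto simp: fact_lengths_def S_def)
  moreover have "S \<in> Z" using sum_irr_mem[OF irr_xy(1)] by (simp add: S_def)
  ultimately show ?thesis
    using S(4) eq by (intro bexI[of _ S] conjI bexI[of _ "size x"] bexI[of _ "size y"])
      (auto simp: fact_lengths_def)
qed

section \<open>Sets of lengths and weak transfer homomorphisms\<close>

definition as_monoid :: "'g multiset monoid" where
  "as_monoid = \<lparr>carrier = Z, monoid.mult = (\<lambda>S T. S + T), one = {#}\<rparr>"

lemma as_monoid_simps [simp]:
  "carrier as_monoid = Z" "S \<otimes>\<^bsub>as_monoid\<^esub> T = S + T" "\<one>\<^bsub>as_monoid\<^esub> = {#}"
  by (simp_all add: as_monoid_def)

lemma Units_as_monoid [simp]: "Units as_monoid = {{#}}"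
  by (auto simp: Units_def zero)

lemma atoms_as_monoid [simp]: "atoms as_monoid = irr"
proof (intro equalityI subsetI)
  fix U assume U: "U \<in> atoms as_monoid"
  have "S = {#} \<or> S = U" if "S \<in> Z" "S \<subseteq># U" for S
  proof -
    have "U = S + (U - S)" "U - S \<in> Z"
      using U that diff by (auto simp: atoms_def)
    then have "S = {#} \<or> U - S = {#}"
      using U that(1) unfolding atoms_def by auto
    then show ?thesis using that(2) by (metis Diff_eq_empty_iff_mset subset_mset.antisym)
  qed
  then show "U \<in> irr" using U by (auto simp: atoms_def irr_def)
qed (auto simp: atoms_def irr_def)

lemma mprod_as_monoid [simp]: "mprod as_monoid us = \<Sum>\<^sub># (mset us)"
  by (induction us) (auto simp: mprod_def)

lemma length_set_as_monoid: "length_set as_monoid S = fact_lengths S"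
proof (cases "S = {#}")
  case True
  have "x = {#}" if "set_mset x \<subseteq> irr" "\<Sum>\<^sub># x = {#}" for x
    using sum_irr_empty that by blast
  then have "fact_lengths S = {0}" using True by (force simp: fact_lengths_def)
  then show ?thesis using True by (simp add: length_set_def)
next
  case False
  have "{k. \<exists>us. length us = k \<and> set us \<subseteq> irr \<and> S = \<Sum>\<^sub># (mset us)} = fact_lengths S"
  proof (intro equalityI subsetI)
    fix k assume "k \<in> fact_lengths S"
    then obtain x where x: "size x = k" "set_mset x \<subseteq> irr" "\<Sum>\<^sub># x = S"
      by (auto simp: fact_lengths_def)
    obtain us where "mset us = x" using ex_mset by blast
    with x show "k \<in> {k. \<exists>us. length us = k \<and> set us \<subseteq> irr \<and> S = \<Sum>\<^sub># (mset us)}"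
      by (auto intro!: exI[of _ us])
  next
    fix k assume "k \<in> {k. \<exists>us. length us = k \<and> set us \<subseteq> irr \<and> S = \<Sum>\<^sub># (mset us)}"
    then obtain us where "length us = k" "set us \<subseteq> irr" "S = \<Sum>\<^sub># (mset us)" by blast
    then show "k \<in> fact_lengths S"
      unfolding fact_lengths_def by (intro CollectI exI[of _ "mset us"]) simp
  qed
  then show ?thesis using False by (simp add: length_set_def)
qed

lemma fact_lengths_nonempty: "S \<in> Z \<Longrightarrow> fact_lengths S \<noteq> {}"
  using factorization_exists[of S] unfolding fact_lengths_def by blast

lemma zero_in_fact_lengths: "0 \<in> fact_lengths S \<Longrightarrow> S = {#}"
  by (auto simp: fact_lengths_def)

text \<open>
  The value \<open>1\<close> is taken by the identity.  For \<open>q > 1\<close>, a supremum of ratios exceeding \<open>q\<close>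
  yields a single length \<open>k\<close> whose ratio to the minimal length exceeds \<open>q\<close>.
\<close>

lemma exists_rational_elasticity:
  assumes q: "1 \<le> q" "ereal (of_rat q) < set_elasticity (fact_lengths A)" and A: "A \<in> Z"
  shows "\<exists>S\<in>Z. set_elasticity (fact_lengths S) = ereal (of_rat q)"
proof (cases "q = 1")
  case True
  have "fact_lengths {#} = {0}"
    using length_set_as_monoid[of "{#}"] by (simp add: length_set_def)
  then have "set_elasticity (fact_lengths {#}) = ereal (of_rat q)"
    using True by (simp add: set_elasticity_def one_ereal_def)
  then show ?thesis using zero by blast
next
  case False
  obtain i j where ij: "quotient_of q = (i, j)" by force
  have "j > 0" using quotient_of_denom_pos[OF ij] .
  have q_ij: "q = of_int i / of_int j" using quotient_of_div[OF ij] .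
  have "i > j" using q(1) False \<open>j > 0\<close> q_ij by (simp add: field_simps)
  define m n where "m = nat i" and "n = nat j"
  have n: "n > 0" and nm: "n < m" using \<open>j > 0\<close> \<open>i > j\<close> by (auto simp: m_def n_def)
  have qr: "of_rat q = real m / real n"
    using q_ij \<open>j > 0\<close> \<open>i > j\<close> by (simp add: of_rat_divide m_def n_def)
  have "of_rat q > (1 :: real)" using n nm by (simp add: qr)
  let ?L = "fact_lengths A"
  have "?L \<noteq> {0}"
  proof
    assume "?L = {0}"
    then have "ereal (of_rat q) < ereal 1"
      using q(2) by (simp add: set_elasticity_def one_ereal_def)
    then show False using \<open>of_rat q > (1 :: real)\<close> by simp
  qed
  moreover have "fact_lengths {#} = {0}"
    using length_set_as_monoid[of "{#}"] by (simp add: length_set_def)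
  ultimately have "A \<noteq> {#}" by metis
  define l where "l = Inf ?L"
  have l: "l \<in> ?L" unfolding l_def using fact_lengths_nonempty[OF A] by (rule Inf_nat_def1)
  then have "l > 0" using zero_in_fact_lengths \<open>A \<noteq> {#}\<close> by (auto intro!: gr0I)
  have "ereal (of_rat q) < (SUP k\<in>?L. ereal (real k)) / ereal (real l)"
    using q(2) \<open>?L \<noteq> {0}\<close> by (simp only: set_elasticity_def l_def if_False)
  then have "ereal (real l) * ereal (of_rat q) < (SUP k\<in>?L. ereal (real k))"
    using \<open>l > 0\<close> by (simp add: ereal_less_divide_pos)
  then obtain k where k: "k \<in> ?L" "real l * of_rat q < real k"
    by (auto simp: less_SUP_iff)
  then have "real (m * l) < real (n * k)"
    using n by (simp add: qr field_simps)
  then have "m * l < n * k" by (simp only: of_nat_less_iff)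
  then obtain S k' l' where S: "S \<in> Z" "S \<noteq> {#}" "k' \<in> fact_lengths S" "l' \<in> fact_lengths S"
      "n * k' = m * l'" "\<And>i. i \<in> fact_lengths S \<Longrightarrow> l' \<le> i \<and> i \<le> k'"
    using exists_extremal_element[OF A k(1) l _ n nm] by blast
  have "l' > 0" using zero_in_fact_lengths S(2,4) by (auto intro!: gr0I)
  have "Inf (fact_lengths S) = l'"
    using S(4,6) by (intro cInf_eq_minimum) auto
  moreover have "(SUP i\<in>fact_lengths S. ereal (real i)) = ereal (real k')"
    using S(3,6) by (intro antisym SUP_least SUP_upper) auto
  moreover have "fact_lengths S \<noteq> {0}" using zero_in_fact_lengths S(2) by blast
  moreover have "real k' / real l' = real m / real n"
  proof -
    have "real n * real k' = real m * real l'" using S(5) by (metis of_nat_mult)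
    then show ?thesis using n \<open>l' > 0\<close> by (simp add: field_simps)
  qed
  ultimately have "set_elasticity (fact_lengths S) = ereal (of_rat q)"
    using \<open>l' > 0\<close> by (simp add: set_elasticity_def qr)
  then show ?thesis using S(1) by blast
qed

context
  fixes H :: "('a, 'm) monoid_scheme" and \<theta> :: "'a \<Rightarrow> 'g multiset"
  assumes wt: "weak_transfer_hom H as_monoid \<theta>"
begin

lemma monoid_H: "monoid H"
  and hom: "\<theta> \<in> hom H as_monoid"
  and map_one: "\<theta> \<one>\<^bsub>H\<^esub> = {#}"
  and carrier_eq: "carrier as_monoid = {{#}} <#>\<^bsub>as_monoid\<^esub> \<theta> ` carrier H <#>\<^bsub>as_monoid\<^esub> {{#}}"
  and units_eq: "{a \<in> carrier H. \<theta> a = {#}} = Units H"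
proof -
  note wt' = wt[unfolded weak_transfer_hom_def atomic_monoid_def monoid_cancel_def
      Units_as_monoid as_monoid_simps(3)]
  show "monoid H" using wt' by (elim conjE)
  show "\<theta> \<in> hom H as_monoid" using wt' by (elim conjE)
  show "\<theta> \<one>\<^bsub>H\<^esub> = {#}" using wt' by (elim conjE)
  show "carrier as_monoid = {{#}} <#>\<^bsub>as_monoid\<^esub> \<theta> ` carrier H <#>\<^bsub>as_monoid\<^esub> {{#}}"
    using wt' by (elim conjE)
  have "{a \<in> carrier H. \<theta> a \<in> {{#}}} = Units H" using wt' by (elim conjE)
  then show "{a \<in> carrier H. \<theta> a = {#}} = Units H" by simp
qed

text \<open>
  The trivial unit group turns \<open>B = B\<^sup>\<times> \<theta>(H) B\<^sup>\<times>\<close> into plain surjectivity.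
\<close>

lemma image_eq: "\<theta> ` carrier H = Z"
proof -
  have "{{#}} <#>\<^bsub>as_monoid\<^esub> \<theta> ` carrier H <#>\<^bsub>as_monoid\<^esub> {{#}} = \<theta> ` carrier H"
    by (auto simp: set_mult_def)
  with carrier_eq have "carrier as_monoid = \<theta> ` carrier H" by (rule trans)
  then show ?thesis by simp
qed

lemma mult_eq: "a \<in> carrier H \<Longrightarrow> b \<in> carrier H \<Longrightarrow> \<theta> (a \<otimes>\<^bsub>H\<^esub> b) = \<theta> a + \<theta> b"
  using hom by (simp add: hom_def)

lemma unit_iff: "a \<in> carrier H \<Longrightarrow> \<theta> a = {#} \<longleftrightarrow> a \<in> Units H"
  using units_eq by blast

lemma mprod_closed: "set us \<subseteq> carrier H \<Longrightarrow> mprod H us \<in> carrier H"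
  using monoid_H by (induction us) (auto simp: mprod_def monoid.m_closed monoid.one_closed)

lemma mprod_eq: "set us \<subseteq> carrier H \<Longrightarrow> \<theta> (mprod H us) = \<Sum>\<^sub># (mset (map \<theta> us))"
proof (induction us)
  case Nil
  then show ?case by (simp add: mprod_def map_one)
next
  case (Cons a us)
  then show ?case using mult_eq[of a "mprod H us"] mprod_closed[of us] by (simp add: mprod_def)
qed

lemma lift_factorization:
  assumes "a \<in> carrier H" "vs \<noteq> []" "set vs \<subseteq> irr" "\<theta> a = \<Sum>\<^sub># (mset vs)"
  shows "\<exists>us. length us = length vs \<and> set us \<subseteq> atoms H \<and> a = mprod H us \<and> (\<forall>u\<in>set us. \<theta> u \<in> set vs)"
proof -
  obtain us \<tau> where us: "length us = length vs" "set us \<subseteq> atoms H" "\<tau> permutes {..<length vs}"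
    "a = mprod H us"
    and ass: "\<forall>i<length vs. \<theta> (us ! i) \<in> {{#}} <#>\<^bsub>as_monoid\<^esub> {vs ! \<tau> i} <#>\<^bsub>as_monoid\<^esub> {{#}}"
    using wt assms unfolding weak_transfer_hom_def atoms_as_monoid mprod_as_monoid Units_as_monoid
    by blast
  have "\<theta> (us ! i) \<in> set vs" if "i < length vs" for i
  proof -
    have "\<theta> (us ! i) = vs ! \<tau> i" using ass that by (auto simp: set_mult_def)
    moreover have "\<tau> i < length vs" using permutes_in_image[OF us(3), of i] that by simp
    ultimately show ?thesis by simp
  qed
  then have "\<forall>u\<in>set us. \<theta> u \<in> set vs" using us(1) by (metis in_set_conv_nth)
  then show ?thesis using us by blast
qed

text \<open>
  A factorization of \<open>\<theta> u\<close> of length \<open>n\<close> lifts to one of \<open>u\<close> into \<open>n\<close> atoms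
  \<open>w, w\<^sub>2, \<dots>, w\<^sub>n\<close>.  As \<open>u\<close> is an atom, \<open>w\<^sub>2 \<cdots> w\<^sub>n\<close> is a unit, so its image
  is trivial although each \<open>\<theta> w\<^sub>i\<close> is nontrivial; this forces \<open>n = 1\<close>.
\<close>

lemma atom_image:
  assumes "u \<in> atoms H"
  shows "\<theta> u \<in> irr"
proof -
  have u: "u \<in> carrier H" "u \<notin> Units H" using assms by (auto simp: atoms_def)
  then have "\<theta> u \<in> Z" "\<theta> u \<noteq> {#}" using image_eq unit_iff by auto
  then obtain x where x: "set_mset x \<subseteq> irr" "\<Sum>\<^sub># x = \<theta> u" using factorization_exists by blast
  obtain vs where vs: "mset vs = x" using ex_mset by blast
  have "vs \<noteq> []" using vs x \<open>\<theta> u \<noteq> {#}\<close> by auto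
  then obtain us where us: "length us = length vs" "set us \<subseteq> atoms H" "u = mprod H us"
      "\<forall>u\<in>set us. \<theta> u \<in> set vs"
    using lift_factorization[OF u(1), of vs] x vs by auto
  obtain w ws where ws: "us = w # ws" using us(1) \<open>vs \<noteq> []\<close> by (cases us) auto
  have at: "a \<in> carrier H" "a \<notin> Units H" if "a \<in> set us" for a
    using us(2) that by (auto simp: atoms_def)
  have c: "w \<in> carrier H" "set ws \<subseteq> carrier H" using at ws by auto
  have "u = w \<otimes>\<^bsub>H\<^esub> mprod H ws" using us(3) ws by (simp add: mprod_def)
  then have "mprod H ws \<in> Units H"
    using assms at[of w] ws mprod_closed[OF c(2)] unfolding atoms_def by auto
  then have "\<Sum>\<^sub># (mset (map \<theta> ws)) = {#}"
    using mprod_eq[OF c(2)] unit_iff[OF mprod_closed[OF c(2)]] by simp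
  moreover have "\<theta> a \<noteq> {#}" if "a \<in> set ws" for a
    using at[of a] that ws unit_iff by auto
  ultimately have "ws = []" by (cases ws) auto
  then have "u = w" using us(3) ws c(1) monoid_H by (simp add: mprod_def monoid.r_one)
  then show ?thesis using us(4) ws x vs by auto
qed

text \<open>
  Images of atoms are atoms, so factorizations map forward keeping their length; the
  lifting property gives the converse.
\<close>

lemma length_set_transfer:
  assumes a: "a \<in> carrier H"
  shows "length_set H a = fact_lengths (\<theta> a)"
proof (cases "a \<in> Units H")
  case True
  then have "\<theta> a = {#}" using unit_iff[OF a] by simp
  then show ?thesis using True length_set_as_monoid[of "{#}"] by (simp add: length_set_def)
next
  case False
  then have ne: "\<theta> a \<noteq> {#}" using unit_iff[OF a] by simp
  have "{k. \<exists>us. length us = k \<and> set us \<subseteq> atoms H \<and> a = mprod H us} = fact_lengths (\<theta> a)"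
  proof (intro equalityI subsetI)
    fix k assume "k \<in> {k. \<exists>us. length us = k \<and> set us \<subseteq> atoms H \<and> a = mprod H us}"
    then obtain us where us: "length us = k" "set us \<subseteq> atoms H" "a = mprod H us" by blast
    then have "set us \<subseteq> carrier H" by (auto simp: atoms_def)
    then have "\<theta> a = \<Sum>\<^sub># (mset (map \<theta> us))" using mprod_eq us(3) by simp
    moreover have "set_mset (mset (map \<theta> us)) \<subseteq> irr" using us(2) atom_image by auto
    ultimately show "k \<in> fact_lengths (\<theta> a)"
      unfolding fact_lengths_def using us(1) by (intro CollectI exI[of _ "mset (map \<theta> us)"]) simp
  next
    fix k assume "k \<in> fact_lengths (\<theta> a)"
    then obtain x where x: "size x = k" "set_mset x \<subseteq> irr" "\<Sum>\<^sub># x = \<theta> a"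
      by (auto simp: fact_lengths_def)
    obtain vs where vs: "mset vs = x" using ex_mset by blast
    have "vs \<noteq> []" using vs x ne by auto
    moreover have "set vs \<subseteq> irr" "\<theta> a = \<Sum>\<^sub># (mset vs)" using x vs by auto
    ultimately obtain us where "length us = length vs" "set us \<subseteq> atoms H" "a = mprod H us"
      using lift_factorization[OF a] by blast
    moreover have "length vs = k" using x vs by auto
    ultimately show "k \<in> {k. \<exists>us. length us = k \<and> set us \<subseteq> atoms H \<and> a = mprod H us}" by auto
  qed
  then show ?thesis using False by (simp add: length_set_def)
qed

lemma fully_elastic_of_weak_transfer: "fully_elastic H"
proof -
  have "length_sets H = (\<lambda>a. fact_lengths (\<theta> a)) ` carrier H"
    unfolding length_sets_def by (intro image_cong refl length_set_transfer)
  also have "\<dots> = fact_lengths ` Z" by (metis image_eq image_image)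
  finally have L: "length_sets H = fact_lengths ` Z" .
  show ?thesis
    unfolding fully_elastic_def
  proof (intro allI impI)
    fix q :: rat assume q: "1 \<le> q \<and> ereal (of_rat q) < elasticity H"
    then obtain A where "A \<in> Z" "ereal (of_rat q) < set_elasticity (fact_lengths A)"
      unfolding elasticity_def L by (auto simp: less_SUP_iff)
    then show "\<exists>L\<in>length_sets H. set_elasticity L = ereal (of_rat q)"
      using exists_rational_elasticity q L by auto
  qed
qed

end

end

section \<open>Zero-sum sequences\<close>

lemma seq_sum_add:
  fixes G (structure)
  assumes G: "comm_group G" and S: "set_mset S \<subseteq> carrier G" and T: "set_mset T \<subseteq> carrier G"
  shows "seq_sum G (S + T) = seq_sum G S \<otimes> seq_sum G T"
proof -
  interpret comm_group G by (rule G)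
  obtain ss where ss: "mset ss = S" using ex_mset by blast
  obtain ts where ts: "mset ts = T" using ex_mset by blast
  have c: "set ss \<subseteq> carrier G" "set ts \<subseteq> carrier G" using S T ss ts by auto
  have closed: "foldr (\<otimes>) xs \<one> \<in> carrier G" if "set xs \<subseteq> carrier G" for xs
    using that by (induction xs) simp_all
  have "foldr (\<otimes>) (ss @ ts) \<one> = foldr (\<otimes>) ss \<one> \<otimes> foldr (\<otimes>) ts \<one>"
    using c(1)
  proof (induction ss)
    case Nil
    then show ?case using closed[OF c(2)] by simp
  next
    case (Cons g ss)
    then show ?case using closed[of ss] closed[OF c(2)] by (simp add: m_assoc)
  qed
  then show ?thesis
    using seq_sum_mset[OF G, of "ss @ ts"] seq_sum_mset[OF G, of ss] seq_sum_mset[OF G, of ts] c ss ts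
    by simp
qed

lemma saturated_zero_sum:
  fixes G (structure)
  assumes G: "comm_group G" and G0: "G0 \<subseteq> carrier G"
  shows "saturated {S. set_mset S \<subseteq> G0 \<and> seq_sum G S = \<one>}"
proof -
  interpret comm_group G by (rule G)
  have closed: "seq_sum G T \<in> carrier G" if "set_mset T \<subseteq> G0" for T
    unfolding seq_sum_def using that G0 by (intro finprod_closed) auto
  have add: "seq_sum G (S + T) = seq_sum G S \<otimes> seq_sum G T"
    if "set_mset S \<subseteq> G0" "set_mset T \<subseteq> G0" for S T
    using seq_sum_add[OF G, of S T] that G0 by blast
  show ?thesis
  proof
    show "{#} \<in> {S. set_mset S \<subseteq> G0 \<and> seq_sum G S = \<one>}" by (simp add: seq_sum_def)
  next
    fix S T
    assume "S \<in> {S. set_mset S \<subseteq> G0 \<and> seq_sum G S = \<one>}" "T \<in> {S. set_mset S \<subseteq> G0 \<and> seq_sum G S = \<one>}"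
    then show "S + T \<in> {S. set_mset S \<subseteq> G0 \<and> seq_sum G S = \<one>}"
      using add[of S T] by simp
  next
    fix S T
    assume "S \<in> {S. set_mset S \<subseteq> G0 \<and> seq_sum G S = \<one>}"
      "S + T \<in> {S. set_mset S \<subseteq> G0 \<and> seq_sum G S = \<one>}"
    then show "T \<in> {S. set_mset S \<subseteq> G0 \<and> seq_sum G S = \<one>}"
      using add[of S T] closed[of T] by simp
  qed
qed

theorem theorem3p1:
  fixes H :: "('a, 'm) monoid_scheme"
  assumes "transfer_Krull_monoid TYPE('g) H"
  shows "fully_elastic H"
proof -
  obtain G :: "'g monoid" and G0 \<theta> where G: "comm_group G" "G0 \<subseteq> carrier G"
    and wt: "weak_transfer_hom H (zero_sum_monoid G G0) \<theta>"
    using assms by (auto simp: transfer_Krull_monoid_def)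
  define Z where "Z = {S. set_mset S \<subseteq> G0 \<and> seq_sum G S = \<one>\<^bsub>G\<^esub>}"
  interpret saturated Z unfolding Z_def using saturated_zero_sum[OF G] .
  have "zero_sum_monoid G G0 = as_monoid"
    by (simp add: zero_sum_monoid_def free_abelian_monoid_def as_monoid_def) (simp add: Z_def)
  with wt show ?thesis by (intro fully_elastic_of_weak_transfer) simp
qed

end
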